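(* Let $n\ge2$, $P,Q\in\Gamma_n$ and $s\in\mathbb{R}$. Let there exist $r,R$ with $0<r\le1\le R<\infty$ such that $r\le p_i/q_i\le R$ for all $i\in\{1,\dots,n\}$. (a) For $s\le-1$, $$\frac{2(r^3+1)}{r^{1+s}}\Phi_s(P\|Q)\le\Psi(P\|Q)\le\frac{2(R^3+1)}{R^{1+s}}\Phi_s(P\|Q),$$ $$\frac{2(r^3+1)}{r^{1+s}}\left[\rho_{\Phi_s}(P\|Q)-\Phi_s(P\|Q)\right]\le\Psi^*(P\|Q)\le\frac{2(R^3+1)}{R^{1+s}}\left[\rho_{\Phi_s}(P\|Q)-\Phi_s(P\|Q)\right]$$ and $$\frac{2(r^3+1)}{r^{1+s}}\left[\beta_{\Phi_s}(r,R)-\Phi_s(P\|Q)\right]\le\beta_\Psi(r,R)-\Psi(P\|Q)\le\frac{2(R^3+1)}{R^{1+s}}\left[\beta_{\Phi_s}(r,R)-\Phi_s(P\|Q)\right].$$ (b) For $s\ge2$, $$\frac{2(R^3+1)}{R^{1+s}}\Phi_s(P\|Q)\le\Psi(P\|Q)\le\frac{2(r^3+1)}{r^{1+s}}\Phi_s(P\|Q),$$ $$\frac{2(R^3+1)}{R^{1+s}}\left[\rho_{\Phi_s}(P\|Q)-\Phi_s(P\|Q)\right]\le\Psi^*(P\|Q)\le\frac{2(r^3+1)}{r^{1+s}}\left[\rho_{\Phi_s}(P\|Q)-\Phi_s(P\|Q)\right]$$ and $$\frac{2(R^3+1)}{R^{1+s}}\left[\beta_{\Phi_s}(r,R)-\Phi_s(P\|Q)\right]\le\beta_\Psi(r,R)-\Psi(P\|Q)\le\frac{2(r^3+1)}{r^{1+s}}\left[\beta_{\Phi_s}(r,R)-\Phi_s(P\|Q)\right].$$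 Here $\beta_\Psi(r,R)=(R-1)(1-r)(R+r)$ and $$\Psi^*(P\|Q)=\rho_\Psi(P\|Q)-\Psi(P\|Q)=\sum_{i=1}^n\frac{(p_i-q_i)^2(p_i^2+q_i^2)}{p_i^2q_i}.$$
   Context: $\Gamma_n=\{P=(p_1,\dots,p_n): p_i>0,\ \sum_{i=1}^n p_i=1\}$, $n\ge2$. For $P,Q\in\Gamma_n$: Symmetric chi-square divergence: $\Psi(P\|Q)=\sum_{i=1}^n\frac{(p_i-q_i)^2(p_i+q_i)}{p_iq_i}$; also $\rho_\Psi(P\|Q)=\Psi(P\|Q)+\sum_{i=1}^n\frac{(p_i-q_i)^2(p_i^2+q_i^2)}{p_i^2q_i}$. Relative information of type $s$: $\Phi_s(P\|Q)=[s(s-1)]^{-1}\left[\sum_{i=1}^n p_i^sq_i^{1-s}-1\right]$ for $s\neq0,1$ (only $s\le-1$ or $s\ge2$ is used here). $\rho_{\Phi_s}(P\|Q)=(s-1)^{-1}\sum_{i=1}^n(p_i-q_i)\left(\frac{p_i}{q_i}\right)^{s-1}$ for $s\ne1$. $\beta_{\Phi_s}(r,R)=\frac{(R-1)(r^s-1)+(1-r)(R^s-1)}{(R-r)s(s-1)}$ for $s\neq0,1$.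
   Formalization: The printed β_Ψ(r,R)=(R-1)(1-r)(R+r) makes the β-inequalities false (P=Q, s=2, r=1/2, R=100); it is replaced by the chord value for ψ(x)=(x-1)²(x+1)/x, namely β_Ψ(r,R)=(R-1)(1-r)(1+rR)/(rR). *)

theory Defs
  imports Complex_Main
begin

text \<open>Vectors in \<open>\<real>\<^sup>n\<close> are functions on \<open>nat\<close>, of which only the values at \<open>1, \<dots>, n\<close> matter.\<close>

definition Gamma_set :: "nat \<Rightarrow> (nat \<Rightarrow> real) set" where
  "Gamma_set n = {p. (\<forall>i\<in>{1..n}. p i > 0) \<and> (\<Sum>i=1..n. p i) = 1}"

definition Psi :: "nat \<Rightarrow> (nat \<Rightarrow> real) \<Rightarrow> (nat \<Rightarrow> real) \<Rightarrow> real" where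
  "Psi n p q = (\<Sum>i=1..n. (p i - q i)^2 * (p i + q i) / (p i * q i))"

definition rho_Psi :: "nat \<Rightarrow> (nat \<Rightarrow> real) \<Rightarrow> (nat \<Rightarrow> real) \<Rightarrow> real" where
  "rho_Psi n p q = Psi n p q
     + (\<Sum>i=1..n. (p i - q i)^2 * ((p i)^2 + (q i)^2) / ((p i)^2 * q i))"

definition Psi_star :: "nat \<Rightarrow> (nat \<Rightarrow> real) \<Rightarrow> (nat \<Rightarrow> real) \<Rightarrow> real" where
  "Psi_star n p q = rho_Psi n p q - Psi n p q"

text \<open>The next three are meaningful for \<open>s \<noteq> 0\<close>, \<open>s \<noteq> 1\<close> only.\<close>

definition Phi :: "real \<Rightarrow> nat \<Rightarrow> (nat \<Rightarrow> real) \<Rightarrow> (nat \<Rightarrow> real) \<Rightarrow> real" where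
  "Phi s n p q = ((\<Sum>i=1..n. p i powr s * q i powr (1 - s)) - 1) / (s * (s - 1))"

definition rho_Phi :: "real \<Rightarrow> nat \<Rightarrow> (nat \<Rightarrow> real) \<Rightarrow> (nat \<Rightarrow> real) \<Rightarrow> real" where
  "rho_Phi s n p q = (\<Sum>i=1..n. (p i - q i) * (p i / q i) powr (s - 1)) / (s - 1)"

definition beta_Phi :: "real \<Rightarrow> real \<Rightarrow> real \<Rightarrow> real" where
  "beta_Phi s r R =
     ((R - 1) * (r powr s - 1) + (1 - r) * (R powr s - 1)) / ((R - r) * s * (s - 1))"

text \<open>
  \<open>\<beta>\<^sub>f(r,R)\<close> is the value at \<open>1\<close> of the chord of \<open>f\<close> over \<open>[r,R]\<close>; \<open>beta_Phi\<close> is the case of the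
  generator of \<open>\<Phi>\<^sub>s\<close> (lemma \<open>beta_Phi_eq\<close>). For \<open>r = R\<close>, which forces \<open>r = R = 1\<close>, both
  are \<open>0 / 0 = 0\<close>, the common value of the generators at \<open>1\<close>.
\<close>

definition beta_gen :: "(real \<Rightarrow> real) \<Rightarrow> real \<Rightarrow> real \<Rightarrow> real" where
  "beta_gen f r R = ((R - 1) * f r + (1 - r) * f R) / (R - r)"

definition phi :: "real \<Rightarrow> real \<Rightarrow> real" where
  "phi s x = (x powr s - 1 - s * (x - 1)) / (s * (s - 1))"

definition psi :: "real \<Rightarrow> real" where
  "psi x = (x - 1)^2 * (x + 1) / x"

text \<open>
  The source evaluates \<open>\<beta>\<^sub>\<Psi>(r,R)\<close> as \<open>(R - 1) (1 - r) (R + r)\<close>. That is a slip: the value is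
  \<open>(R - 1) (1 - r) (1 + r R) / (r R)\<close> (lemma \<open>beta_Psi_closed_form\<close>), and with the printed
  expression the inequalities for \<open>\<beta>\<^sub>\<Psi>\<close> are false (lemma \<open>printed_beta_Psi_refuted\<close>).
  Hence \<open>\<beta>\<^sub>\<Psi>\<close> is defined here by the general formula.
\<close>

definition beta_Psi :: "real \<Rightarrow> real \<Rightarrow> real" where
  "beta_Psi r R = beta_gen psi r R"

lemma Psi_eq_generator:
  assumes "p \<in> Gamma_set n" "q \<in> Gamma_set n"
  shows "Psi n p q = (\<Sum>i=1..n. q i * psi (p i / q i))"
proof -
  have "(a - b)^2 * (a + b) / (a * b) = b * psi (a / b)" if "a > 0" "b > 0" for a b :: real
    using that by (simp add: psi_def field_simps power2_eq_square)
  then show ?thesis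
    using assms unfolding Psi_def Gamma_set_def by (intro sum.cong) auto
qed

lemma Phi_eq_generator:
  assumes "p \<in> Gamma_set n" "q \<in> Gamma_set n"
  shows "Phi s n p q = (\<Sum>i=1..n. q i * phi s (p i / q i))"
proof -
  have *: "b * phi s (a / b) = (a powr s * b powr (1 - s) - b - s * (a - b)) / (s * (s - 1))"
    if "a > 0" "b > 0" for a b :: real
  proof -
    have "b * (a / b) powr s = a powr s * b powr (1 - s)"
      using that by (simp add: powr_divide powr_diff)
    then have "b * ((a / b) powr s - 1 - s * (a / b - 1))
        = a powr s * b powr (1 - s) - b - s * (a - b)"
      using that by (simp add: right_diff_distrib)
    then show ?thesis by (simp add: phi_def)
  qed
  have "(\<Sum>i=1..n. q i * phi s (p i / q i))
      = (\<Sum>i=1..n. (p i powr s * q i powr (1 - s) - q i - s * (p i - q i)) / (s * (s - 1)))"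
    using assms by (intro sum.cong) (auto simp: Gamma_set_def *)
  also have "\<dots> = Phi s n p q"
    using assms unfolding Phi_def Gamma_set_def
    by (simp add: sum_divide_distrib[symmetric] sum_subtractf sum_distrib_left[symmetric])
  finally show ?thesis by simp
qed

lemma beta_Phi_eq: "beta_Phi s r R = beta_gen (phi s) r R"
proof -
  have "(R - 1) * (r powr s - 1) + (1 - r) * (R powr s - 1)
      = (R - 1) * (r powr s - 1 - s * (r - 1)) + (1 - r) * (R powr s - 1 - s * (R - 1))"
    by algebra
  then show ?thesis
    by (simp add: beta_Phi_def beta_gen_def phi_def add_divide_distrib[symmetric] mult.assoc mult.commute)
qed

lemma beta_Psi_closed_form:
  assumes "0 < r" "r \<le> 1" "1 \<le> R"
  shows "beta_Psi r R = (R - 1) * (1 - r) * (1 + r * R) / (r * R)"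
proof (cases "r = R")
  case True
  then show ?thesis using assms by (simp add: beta_Psi_def beta_gen_def)
next
  case False
  then have "r < R" using assms by simp
  have "((R - 1) * psi r + (1 - r) * psi R) * (r * R)
      = (R - 1) * (1 - r) * (1 + r * R) * (R - r)"
    using assms unfolding psi_def by (simp add: field_simps) algebra
  then show ?thesis
    using assms \<open>r < R\<close> unfolding beta_Psi_def beta_gen_def by (simp add: frac_eq_eq)
qed

lemma printed_beta_Psi_refuted:
  defines "p \<equiv> \<lambda>i. 1/2" and "r \<equiv> 1/2" and "R \<equiv> 100"
  shows "p \<in> Gamma_set 2" "0 < r" "r \<le> 1" "1 \<le> R" "\<forall>i\<in>{1..2}. r \<le> p i / p i \<and> p i / p i \<le> R"
    "\<not> (R - 1) * (1 - r) * (R + r) - Psi 2 p p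
         \<le> 2 * (r^3 + 1) / r powr (1 + 2) * (beta_Phi 2 r R - Phi 2 2 p p)"
proof -
  have "(1/2::real) powr 2 = 1/4" "(1/2::real) powr 3 = 1/8" "(1/2::real) powr (-1) = 2"
    "(100::real) powr 2 = 10000"
    by (simp_all add: powr_numeral powr_minus power2_eq_square power3_eq_cube)
  then have "beta_Phi 2 r R = 99/4" "Phi 2 2 p p = 0" "Psi 2 p p = 0" "r powr (1 + 2) = 1/8"
    by (simp_all del: powr_numeral
        add: p_def r_def R_def Psi_def Phi_def beta_Phi_def)
  then show "\<not> (R - 1) * (1 - r) * (R + r) - Psi 2 p p
         \<le> 2 * (r^3 + 1) / r powr (1 + 2) * (beta_Phi 2 r R - Phi 2 2 p p)"
    by (simp add: r_def R_def power3_eq_cube)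
qed (auto simp: p_def r_def R_def Gamma_set_def)

end

theory Submission
  imports Defs "HOL-Analysis.Convex"
begin

text \<open>
  With \<open>C\<^sub>f = \<Sum> q\<^sub>i f (p\<^sub>i / q\<^sub>i)\<close> and \<open>\<rho>\<^sub>f = \<Sum> (p\<^sub>i - q\<^sub>i) f' (p\<^sub>i / q\<^sub>i)\<close>, a convex \<open>f\<close> with
  \<open>f 1 = 0\<close> satisfies \<open>0 \<le> C\<^sub>f\<close> and \<open>C\<^sub>f \<le> \<rho>\<^sub>f\<close> (tangents at \<open>1\<close> and at \<open>p\<^sub>i / q\<^sub>i\<close>) and \<open>C\<^sub>f \<le> \<beta>\<^sub>f\<close>
  (chord over \<open>[r,R]\<close>). All three expressions are linear in \<open>f\<close>, so they can be applied to
  \<open>\<psi> - c \<phi>\<^sub>s\<close> and \<open>c \<phi>\<^sub>s - \<psi>\<close>, where \<open>c\<close> is an extreme value on \<open>[r,R]\<close> of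
  \<open>\<psi>'' x / \<phi>\<^sub>s'' x = 2 (x\<^sup>3 + 1) / x\<^bsup>1+s\<^esup>\<close>, a function increasing for \<open>s \<le> -1\<close> and decreasing
  for \<open>s \<ge> 2\<close>.
\<close>

section \<open>The functionals attached to a generator, and their linearity\<close>

definition csiszar :: "nat \<Rightarrow> (nat \<Rightarrow> real) \<Rightarrow> (nat \<Rightarrow> real) \<Rightarrow> (real \<Rightarrow> real) \<Rightarrow> real" where
  "csiszar n p q f = (\<Sum>i=1..n. q i * f (p i / q i))"

definition csiszar_rho :: "nat \<Rightarrow> (nat \<Rightarrow> real) \<Rightarrow> (nat \<Rightarrow> real) \<Rightarrow> (real \<Rightarrow> real) \<Rightarrow> real" where
  "csiszar_rho n p q f' = (\<Sum>i=1..n. (p i - q i) * f' (p i / q i))"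

lemma csiszar_lincomb:
  "csiszar n p q (\<lambda>x. b * g x - a * f x) = b * csiszar n p q g - a * csiszar n p q f"
  by (simp add: csiszar_def sum_distrib_left sum_subtractf[symmetric] algebra_simps)

lemma csiszar_rho_lincomb:
  "csiszar_rho n p q (\<lambda>x. b * g x - a * f x) = b * csiszar_rho n p q g - a * csiszar_rho n p q f"
  by (simp add: csiszar_rho_def sum_distrib_left sum_subtractf[symmetric] algebra_simps)

lemma beta_gen_lincomb:
  "beta_gen (\<lambda>x. b * g x - a * f x) r R = b * beta_gen g r R - a * beta_gen f r R"
proof -
  have "(R - 1) * (b * g r - a * f r) + (1 - r) * (b * g R - a * f R)
      = b * ((R - 1) * g r + (1 - r) * g R) - a * ((R - 1) * f r + (1 - r) * f R)"
    by algebra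
  then show ?thesis
    by (simp add: beta_gen_def diff_divide_distrib)
qed

section \<open>Bounds for one convex generator and comparison of two\<close>

lemma convex_on_le_chord:
  fixes f :: "real \<Rightarrow> real"
  assumes "convex_on {r..R} f" "r \<le> x" "x \<le> R"
  shows "(R - r) * f x \<le> (R - x) * f r + (x - r) * f R"
proof (cases "r = R")
  case True
  then show ?thesis using assms by simp
next
  case False
  then have "r < R" using assms by simp
  have "f x \<le> (f R - f r) / (R - r) * (x - r) + f r"
    using convex_onD_Icc'[OF assms(1), of x] assms by simp
  then show ?thesis
    using \<open>r < R\<close> by (simp add: field_simps)
qed

lemma csiszar_convex_bounds:
  assumes p: "p \<in> Gamma_set n" and q: "q \<in> Gamma_set n"
    and r: "r \<le> 1" and R: "1 \<le> R"
    and ratio: "\<And>i. i \<in> {1..n} \<Longrightarrow> p i / q i \<in> {r..R}"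
    and f': "\<And>x. x \<in> {r..R} \<Longrightarrow> (f has_real_derivative f' x) (at x)"
    and f'': "\<And>x. x \<in> {r..R} \<Longrightarrow> (f' has_real_derivative f'' x) (at x)"
    and nonneg: "\<And>x. x \<in> {r..R} \<Longrightarrow> 0 \<le> f'' x"
    and f1: "f 1 = 0"
  shows "0 \<le> csiszar n p q f" "csiszar n p q f \<le> csiszar_rho n p q f'"
    "csiszar n p q f \<le> beta_gen f r R"
proof -
  have pos: "q i > 0" if "i \<in> {1..n}" for i using q that by (simp add: Gamma_set_def)
  have sp: "sum p {1..n} = 1" and sq: "sum q {1..n} = 1"
    using p q by (simp_all add: Gamma_set_def)
  have tangent: "f' x * (y - x) \<le> f y - f x" if "x \<in> {r..R}" "y \<in> {r..R}" for x y
    by (rule f''_imp_f'[of "{r..R}" f f' f'']) (use f' f'' nonneg that in auto)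
  \<comment> \<open>Weighted by \<open>q i\<close>, the tangents at 1 contribute
    \<open>f' 1 * (p i - q i)\<close>, and these cancel in the sum because \<open>p\<close> and
    \<open>q\<close> have the same total mass.\<close>
  have "0 = (\<Sum>i=1..n. f' 1 * (p i - q i))"
    using sp sq by (simp only: sum_distrib_left[symmetric] sum_subtractf diff_self mult_zero_right)
  also have "\<dots> \<le> csiszar n p q f"
    unfolding csiszar_def
  proof (rule sum_mono)
    fix i assume i: "i \<in> {1..n}"
    have "q i * (f' 1 * (p i / q i - 1)) \<le> q i * f (p i / q i)"
      using tangent[of 1 "p i / q i"] ratio[OF i] pos[OF i] r R f1
      by (intro mult_left_mono) auto
    moreover have "q i * (f' 1 * (p i / q i - 1)) = f' 1 * (p i - q i)"
      using pos[OF i] by (simp add: field_simps)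
    ultimately show "f' 1 * (p i - q i) \<le> q i * f (p i / q i)" by simp
  qed
  finally show "0 \<le> csiszar n p q f" .
  show "csiszar n p q f \<le> csiszar_rho n p q f'"
    unfolding csiszar_def csiszar_rho_def
  proof (rule sum_mono)
    fix i assume i: "i \<in> {1..n}"
    \<comment> \<open>The tangent at \<open>p i / q i\<close> is evaluated at 1, where
      \<open>f\<close> vanishes.\<close>
    have "q i * f (p i / q i) \<le> q i * (f' (p i / q i) * (p i / q i - 1))"
      using tangent[of "p i / q i" 1] ratio[OF i] pos[OF i] r R f1
      by (intro mult_left_mono) (auto simp: algebra_simps)
    also have "\<dots> = (p i - q i) * f' (p i / q i)"
      using pos[OF i] by (simp add: field_simps)
    finally show "q i * f (p i / q i) \<le> (p i - q i) * f' (p i / q i)" .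
  qed
  show "csiszar n p q f \<le> beta_gen f r R"
  proof (cases "r = R")
    \<comment> \<open>Here \<open>r = R = 1\<close>, so every ratio is 1 and the sum vanishes;
      \<open>beta_gen\<close> is a quotient by zero, hence 0 as well.\<close>
    case True
    then have "f (p i / q i) = 0" if "i \<in> {1..n}" for i
    proof -
      have "p i / q i = 1" using ratio[OF that] True r R by auto
      then show ?thesis using f1 by simp
    qed
    then show ?thesis using True by (simp add: csiszar_def beta_gen_def)
  next
    case False
    then have "r < R" using r R by simp
    have convex: "convex_on {r..R} f"
      by (rule f''_ge0_imp_convex[of "{r..R}" f f' f'']) (use f' f'' nonneg in auto)
    \<comment> \<open>The chord is affine, so weighting it by \<open>q i\<close> gives a linear
      combination of \<open>q i\<close> and \<open>p i\<close>. Its sum depends only on the two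
      total masses, which turns it into the chord value at 1.\<close>
    have "(R - r) * csiszar n p q f
        \<le> (\<Sum>i=1..n. (R * f r - r * f R) * q i + (f R - f r) * p i)"
      unfolding csiszar_def sum_distrib_left
    proof (rule sum_mono)
      fix i assume i: "i \<in> {1..n}"
      have "q i * ((R - r) * f (p i / q i))
          \<le> q i * ((R - p i / q i) * f r + (p i / q i - r) * f R)"
        using convex_on_le_chord[OF convex, of "p i / q i"] ratio[OF i] pos[OF i]
        by (intro mult_left_mono) auto
      also have "\<dots> = (R * f r - r * f R) * q i + (f R - f r) * p i"
        using pos[OF i] by (simp add: field_simps)
      finally show "(R - r) * (q i * f (p i / q i))
          \<le> (R * f r - r * f R) * q i + (f R - f r) * p i"
        by (simp add: mult.left_commute)
    qed
    also have "\<dots> = (R - 1) * f r + (1 - r) * f R"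
      unfolding sum.distrib sum_distrib_left[symmetric] sp sq by (simp add: algebra_simps)
    finally show ?thesis
      using \<open>r < R\<close> by (simp add: beta_gen_def field_simps)
  qed
qed

text \<open>A coefficient on each side makes the statement symmetric in the two generators:
  exchanging their roles, with coefficient 1 on \<psi>, yields both the lower and the upper bounds.
  The hypothesis \<open>le\<close> says that \<open>b * g - a * f\<close> has nonnegative second
  derivative.\<close>

lemma csiszar_comparison:
  assumes p: "p \<in> Gamma_set n" and q: "q \<in> Gamma_set n"
    and r: "r \<le> 1" and R: "1 \<le> R"
    and ratio: "\<And>i. i \<in> {1..n} \<Longrightarrow> p i / q i \<in> {r..R}"
    and f': "\<And>x. x \<in> {r..R} \<Longrightarrow> (f has_real_derivative f' x) (at x)"
    and f'': "\<And>x. x \<in> {r..R} \<Longrightarrow> (f' has_real_derivative f'' x) (at x)"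
    and f1: "f 1 = 0"
    and g': "\<And>x. x \<in> {r..R} \<Longrightarrow> (g has_real_derivative g' x) (at x)"
    and g'': "\<And>x. x \<in> {r..R} \<Longrightarrow> (g' has_real_derivative g'' x) (at x)"
    and g1: "g 1 = 0"
    and le: "\<And>x. x \<in> {r..R} \<Longrightarrow> a * f'' x \<le> b * g'' x"
  shows "a * csiszar n p q f \<le> b * csiszar n p q g"
    "a * (csiszar_rho n p q f' - csiszar n p q f) \<le> b * (csiszar_rho n p q g' - csiszar n p q g)"
    "a * (beta_gen f r R - csiszar n p q f) \<le> b * (beta_gen g r R - csiszar n p q g)"
proof -
  define h where "h = (\<lambda>x. b * g x - a * f x)"
  define h' where "h' = (\<lambda>x. b * g' x - a * f' x)"
  define h'' where "h'' = (\<lambda>x. b * g'' x - a * f'' x)"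
  have h': "(h has_real_derivative h' x) (at x)"
    and h'': "(h' has_real_derivative h'' x) (at x)"
    and nonneg: "0 \<le> h'' x" if "x \<in> {r..R}" for x
    unfolding h_def h'_def h''_def using le[OF that]
    by (auto intro!: DERIV_diff DERIV_cmult f'[OF that] f''[OF that] g'[OF that] g''[OF that])
  have "h 1 = 0" by (simp add: h_def f1 g1)
  note * = csiszar_convex_bounds[OF p q r R ratio h' h'' nonneg this]
  from *(1) show "a * csiszar n p q f \<le> b * csiszar n p q g"
    by (simp add: h_def csiszar_lincomb)
  from *(2) show "a * (csiszar_rho n p q f' - csiszar n p q f)
      \<le> b * (csiszar_rho n p q g' - csiszar n p q g)"
    by (simp add: h_def h'_def csiszar_lincomb csiszar_rho_lincomb algebra_simps)
  from *(3) show "a * (beta_gen f r R - csiszar n p q f) \<le> b * (beta_gen g r R - csiszar n p q g)"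
    by (simp add: h_def csiszar_lincomb beta_gen_lincomb algebra_simps)
qed

section \<open>Derivatives of the two generators and the sums they produce\<close>

lemma phi_has_derivative:
  assumes "0 < x" "s \<noteq> 0" "s \<noteq> 1"
  shows "(phi s has_real_derivative (x powr (s - 1) - 1) / (s - 1)) (at x)"
proof -
  have "(phi s has_real_derivative (s * x powr (s - 1) - s) / (s * (s - 1))) (at x)"
    unfolding phi_def using assms by (auto intro!: derivative_eq_intros)
  also have "s * x powr (s - 1) - s = s * (x powr (s - 1) - 1)" by algebra
  finally show ?thesis using assms by simp
qed

lemma phi_has_second_derivative:
  assumes "0 < x" "s \<noteq> 1"
  shows "((\<lambda>x. (x powr (s - 1) - 1) / (s - 1)) has_real_derivative x powr (s - 2)) (at x)"
proof -
  have "s - 1 - 1 = s - 2" by simp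
  then show ?thesis
    by (auto intro!: derivative_eq_intros simp: assms)
qed

lemma psi_has_derivative:
  assumes "0 < x"
  shows "(psi has_real_derivative 2 * x - 1 - 1 / x\<^sup>2) (at x)"
proof -
  \<comment> \<open>Expanding \<open>psi\<close> into powers of \<open>x\<close> makes
    differentiation immediate. The two expressions differ at 0, so the derivative is carried over on
    the open half-line \<open>{0<..}\<close>.\<close>
  have 1: "((\<lambda>x. x\<^sup>2 - x - 1 + 1 / x) has_real_derivative 2 * x - 1 - 1 / x\<^sup>2) (at x)"
    using assms by (auto intro!: derivative_eq_intros simp: power2_eq_square)
  have 2: "y\<^sup>2 - y - 1 + 1 / y = psi y" if "y \<in> {0<..}" for y
    using that by (simp add: psi_def field_simps power2_eq_square)
  show ?thesis
    by (rule has_field_derivative_transform_within_open[OF 1 open_greaterThan _ 2]) (use assms in auto)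
qed

lemma psi_has_second_derivative:
  assumes "0 < x"
  shows "((\<lambda>x. 2 * x - 1 - 1 / x\<^sup>2) has_real_derivative 2 * (x ^ 3 + 1) / x ^ 3) (at x)"
proof -
  have "((\<lambda>x. 2 * x - 1 - 1 / x\<^sup>2) has_real_derivative 2 + 2 * x / x ^ 4) (at x)"
    using assms by (auto intro!: derivative_eq_intros simp flip: power_mult)
  moreover have "2 + 2 * x / x ^ 4 = 2 * (x ^ 3 + 1) / x ^ 3"
    using assms by (simp add: field_simps eval_nat_numeral)
  ultimately show ?thesis by simp
qed

lemma csiszar_rho_psi:
  assumes "p \<in> Gamma_set n" "q \<in> Gamma_set n"
  shows "csiszar_rho n p q (\<lambda>x. 2 * x - 1 - 1 / x\<^sup>2) = rho_Psi n p q"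
proof -
  \<comment> \<open>With u = a / b this is the factorization 2 u^3 - u^2 - 1 = (u - 1) (2 u^2 + u +
    1), so the identity holds term by term.\<close>
  have "(a - b) * (2 * (a / b) - 1 - 1 / (a / b)\<^sup>2)
      = (a - b)\<^sup>2 * (a + b) / (a * b) + (a - b)\<^sup>2 * (a\<^sup>2 + b\<^sup>2) / (a\<^sup>2 * b)"
    if "0 < a" "0 < b" for a b :: real
    using that by (simp add: field_simps power2_eq_square)
  then show ?thesis
    using assms unfolding csiszar_rho_def rho_Psi_def Psi_def sum.distrib[symmetric]
    by (intro sum.cong) (auto simp: Gamma_set_def)
qed

text \<open>Unlike for \<psi>, the identity holds only after summation: the constant part of the
  derivative contributes a multiple of the sum of \<open>p i - q i\<close>, which is 0.\<close>

lemma csiszar_rho_phi: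
  assumes "p \<in> Gamma_set n" "q \<in> Gamma_set n"
  shows "csiszar_rho n p q (\<lambda>x. (x powr (s - 1) - 1) / (s - 1)) = rho_Phi s n p q"
proof -
  have "csiszar_rho n p q (\<lambda>x. (x powr (s - 1) - 1) / (s - 1))
      = ((\<Sum>i=1..n. (p i - q i) * (p i / q i) powr (s - 1)) - (\<Sum>i=1..n. p i - q i)) / (s - 1)"
    unfolding csiszar_rho_def sum_subtractf[symmetric] sum_divide_distrib
    by (intro sum.cong) (simp_all add: right_diff_distrib)
  also have "(\<Sum>i=1..n. p i - q i) = 0"
    using assms by (simp add: Gamma_set_def sum_subtractf)
  finally show ?thesis by (simp add: rho_Phi_def)
qed

section \<open>The quotient of second derivatives and the resulting bounds\<close>

definition curvature_ratio :: "real \<Rightarrow> real \<Rightarrow> real" where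
  "curvature_ratio s x = 2 * (x ^ 3 + 1) / x powr (1 + s)"

lemma curvature_ratio_mult:
  assumes "0 < x"
  shows "curvature_ratio s x * x powr (s - 2) = 2 * (x ^ 3 + 1) / x ^ 3"
proof -
  have "x powr (1 + s) = x powr (s - 2) * x ^ 3"
    using powr_add[of x "s - 2" 3] assms by (simp add: add.commute)
  then show ?thesis
    using assms by (simp add: curvature_ratio_def)
qed

text \<open>This form explains the two ranges of \<open>s\<close>: the exponents
  \<open>2 - s\<close> and \<open>-1 - s\<close> are both nonnegative exactly for
  \<open>s \<le> -1\<close> and both nonpositive exactly for \<open>s \<ge> 2\<close>, so
  monotonicity can be read off each summand.\<close>

lemma curvature_ratio_eq:
  assumes "0 < x"
  shows "curvature_ratio s x = 2 * (x powr (2 - s) + x powr (-1 - s))"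
proof -
  have "x ^ 3 / x powr (1 + s) = x powr (2 - s)"
    using powr_diff[of x 3 "1 + s"] assms by simp
  moreover have "1 / x powr (1 + s) = x powr (-1 - s)"
    using powr_minus_divide[of x "1 + s"] by simp
  ultimately show ?thesis
    unfolding curvature_ratio_def times_divide_eq_right[symmetric] add_divide_distrib by simp
qed

lemma curvature_ratio_mono:
  assumes "s \<le> -1" "0 < x" "x \<le> y"
  shows "curvature_ratio s x \<le> curvature_ratio s y"
  using assms by (simp add: curvature_ratio_eq add_mono powr_mono2)

lemma curvature_ratio_antimono:
  assumes "s \<ge> 2" "0 < x" "x \<le> y"
  shows "curvature_ratio s y \<le> curvature_ratio s x"
  using assms by (simp add: curvature_ratio_eq add_mono powr_mono2')

text \<open>The constant \<open>c\<close> is left arbitrary because the endpoint at which the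
  quotient is smallest depends on the range of \<open>s\<close>; each half then serves both
  ranges.\<close>

lemma Psi_bounds:
  assumes p: "p \<in> Gamma_set n" and q: "q \<in> Gamma_set n"
    and r0: "0 < r" and r: "r \<le> 1" and R: "1 \<le> R"
    and ratio: "\<forall>i\<in>{1..n}. r \<le> p i / q i \<and> p i / q i \<le> R"
    and s: "s \<noteq> 0" "s \<noteq> 1"
  shows Psi_lower_bounds: "\<forall>x\<in>{r..R}. c \<le> curvature_ratio s x \<Longrightarrow>
      c * Phi s n p q \<le> Psi n p q \<and>
      c * (rho_Phi s n p q - Phi s n p q) \<le> Psi_star n p q \<and>
      c * (beta_Phi s r R - Phi s n p q) \<le> beta_Psi r R - Psi n p q"
    and Psi_upper_bounds: "\<forall>x\<in>{r..R}. curvature_ratio s x \<le> c \<Longrightarrow>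
      Psi n p q \<le> c * Phi s n p q \<and>
      Psi_star n p q \<le> c * (rho_Phi s n p q - Phi s n p q) \<and>
      beta_Psi r R - Psi n p q \<le> c * (beta_Phi s r R - Phi s n p q)"
proof -
  have pos: "0 < x" if "x \<in> {r..R}" for x using r0 that by simp
  have ratio': "p i / q i \<in> {r..R}" if "i \<in> {1..n}" for i using ratio that by simp
  have Psi: "csiszar n p q psi = Psi n p q" and Phi: "csiszar n p q (phi s) = Phi s n p q"
    using Psi_eq_generator[OF p q] Phi_eq_generator[OF p q] by (simp_all add: csiszar_def)
  have at_1: "psi 1 = 0" "phi s 1 = 0" by (simp_all add: psi_def phi_def)
  note phi' = phi_has_derivative[OF pos s] phi_has_second_derivative[OF pos s(2)]
  note psi' = psi_has_derivative[OF pos] psi_has_second_derivative[OF pos]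
  note translate = Psi Phi csiszar_rho_psi[OF p q] csiszar_rho_phi[OF p q]
    beta_Phi_eq[symmetric] beta_Psi_def[symmetric] mult_1
  {
    assume c: "\<forall>x\<in>{r..R}. c \<le> curvature_ratio s x"
    \<comment> \<open>The factor 1 lets the inequality match the hypothesis \<open>le\<close> of
      \<open>csiszar_comparison\<close>; \<open>mult_1\<close> in \<open>translate\<close> removes
      it again.\<close>
    have "c * x powr (s - 2) \<le> 1 * (2 * (x ^ 3 + 1) / x ^ 3)" if "x \<in> {r..R}" for x
      using mult_right_mono[OF bspec[OF c that], of "x powr (s - 2)"]
      by (simp add: curvature_ratio_mult[OF pos[OF that]])
    from csiszar_comparison[OF p q r R ratio' phi' at_1(2) psi' at_1(1) this]
    show "c * Phi s n p q \<le> Psi n p q \<and>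
      c * (rho_Phi s n p q - Phi s n p q) \<le> Psi_star n p q \<and>
      c * (beta_Phi s r R - Phi s n p q) \<le> beta_Psi r R - Psi n p q"
      unfolding translate Psi_star_def by blast
  }
  {
    assume c: "\<forall>x\<in>{r..R}. curvature_ratio s x \<le> c"
    have "1 * (2 * (x ^ 3 + 1) / x ^ 3) \<le> c * x powr (s - 2)" if "x \<in> {r..R}" for x
      using mult_right_mono[OF bspec[OF c that], of "x powr (s - 2)"]
      by (simp add: curvature_ratio_mult[OF pos[OF that]])
    from csiszar_comparison[OF p q r R ratio' psi' at_1(1) phi' at_1(2) this]
    show "Psi n p q \<le> c * Phi s n p q \<and>
      Psi_star n p q \<le> c * (rho_Phi s n p q - Phi s n p q) \<and>
      beta_Psi r R - Psi n p q \<le> c * (beta_Phi s r R - Phi s n p q)"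
      unfolding translate Psi_star_def by blast
  }
qed

theorem theorem5p2:
  fixes n :: nat and p q :: "nat \<Rightarrow> real" and s r R :: real
  assumes "n \<ge> 2"
    and "p \<in> Gamma_set n" and "q \<in> Gamma_set n"
    and "0 < r" and "r \<le> 1" and "1 \<le> R"
    and "\<forall>i\<in>{1..n}. r \<le> p i / q i \<and> p i / q i \<le> R"
  shows
    "(s \<le> -1 \<longrightarrow>
        (2 * (r^3 + 1) / r powr (1 + s) * Phi s n p q \<le> Psi n p q \<and>
         Psi n p q \<le> 2 * (R^3 + 1) / R powr (1 + s) * Phi s n p q) \<and>
        (2 * (r^3 + 1) / r powr (1 + s) * (rho_Phi s n p q - Phi s n p q) \<le> Psi_star n p q \<and>
         Psi_star n p q \<le> 2 * (R^3 + 1) / R powr (1 + s) * (rho_Phi s n p q - Phi s n p q)) \<and>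
        (2 * (r^3 + 1) / r powr (1 + s) * (beta_Phi s r R - Phi s n p q)
           \<le> beta_Psi r R - Psi n p q \<and>
         beta_Psi r R - Psi n p q
           \<le> 2 * (R^3 + 1) / R powr (1 + s) * (beta_Phi s r R - Phi s n p q))) \<and>
     (s \<ge> 2 \<longrightarrow>
        (2 * (R^3 + 1) / R powr (1 + s) * Phi s n p q \<le> Psi n p q \<and>
         Psi n p q \<le> 2 * (r^3 + 1) / r powr (1 + s) * Phi s n p q) \<and>
        (2 * (R^3 + 1) / R powr (1 + s) * (rho_Phi s n p q - Phi s n p q) \<le> Psi_star n p q \<and>
         Psi_star n p q \<le> 2 * (r^3 + 1) / r powr (1 + s) * (rho_Phi s n p q - Phi s n p q)) \<and>
        (2 * (R^3 + 1) / R powr (1 + s) * (beta_Phi s r R - Phi s n p q)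
           \<le> beta_Psi r R - Psi n p q \<and>
         beta_Psi r R - Psi n p q
           \<le> 2 * (r^3 + 1) / r powr (1 + s) * (beta_Phi s r R - Phi s n p q))) \<and>
     Psi_star n p q = rho_Psi n p q - Psi n p q \<and>
     Psi_star n p q = (\<Sum>i=1..n. (p i - q i)^2 * ((p i)^2 + (q i)^2) / ((p i)^2 * q i))"
proof -
  note lower = Psi_lower_bounds[OF assms(2-7)] and upper = Psi_upper_bounds[OF assms(2-7)]
  \<comment> \<open>By monotonicity the extreme values over \<open>{r..R}\<close> are taken at the
    endpoints, which exchange roles between \<open>a\<close> and \<open>b\<close>.\<close>
  have a: "\<forall>x\<in>{r..R}. curvature_ratio s r \<le> curvature_ratio s x"
    "\<forall>x\<in>{r..R}. curvature_ratio s x \<le> curvature_ratio s R" if "s \<le> -1"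
    using that \<open>0 < r\<close> by (simp_all add: curvature_ratio_mono)
  have b: "\<forall>x\<in>{r..R}. curvature_ratio s R \<le> curvature_ratio s x"
    "\<forall>x\<in>{r..R}. curvature_ratio s x \<le> curvature_ratio s r" if "s \<ge> 2"
    using that \<open>0 < r\<close> by (simp_all add: curvature_ratio_antimono)
  have star: "Psi_star n p q
      = (\<Sum>i=1..n. (p i - q i)^2 * ((p i)^2 + (q i)^2) / ((p i)^2 * q i))"
    by (simp add: Psi_star_def rho_Psi_def)
  have "s \<noteq> 0 \<and> s \<noteq> 1" if "s \<le> -1 \<or> s \<ge> 2"
    using that by auto
  then show ?thesis
    using lower[OF _ _ a(1)] upper[OF _ _ a(2)] lower[OF _ _ b(1)] upper[OF _ _ b(2)]
    unfolding curvature_ratio_def star[symmetric] by (simp add: Psi_star_def)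
qed

end
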